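(* Let $p\in(1,\infty)\setminus\{2\}$ and let $T:\ell_p\to\ell_p$ be an onto linear isometry. Then $T$ is a signed permutation operator, i.e., there exist a bijection $\sigma:\mathbb{N}\to\mathbb{N}$ and scalars $c_n\in\mathbb{K}$ with $|c_n|=1$ for every $n\in\mathbb{N}$ such that $T(x)=(c_nx_{\sigma(n)})_{n\in\mathbb{N}}$ for every $x=(x_n)_{n\in\mathbb{N}}\in\ell_p$.
   Context: $\mathbb{K}$ is $\mathbb{R}$ or $\mathbb{C}$, and $\ell_p$ is the space of $p$-summable sequences in $\mathbb{K}$ with norm $\|x\|_p=(\sum_n|x_n|^p)^{1/p}$. *)

theory Defs
  imports "HOL-Analysis.Analysis"
begin

(* Everything is polymorphic in the scalar type, to be used at real and complex.
   Operators on the sequence space are functions on all sequences whose values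
   outside the carrier set lp p are irrelevant. *)

definition lp :: "real \<Rightarrow> (nat \<Rightarrow> 'a::real_normed_field) set" where
  "lp p = {x. summable (\<lambda>n. norm (x n) powr p)}"

definition lp_norm :: "real \<Rightarrow> (nat \<Rightarrow> 'a::real_normed_field) \<Rightarrow> real" where
  "lp_norm p x = (\<Sum>n. norm (x n) powr p) powr (1 / p)"

definition lp_linear ::
  "real \<Rightarrow> ((nat \<Rightarrow> 'a::real_normed_field) \<Rightarrow> (nat \<Rightarrow> 'a)) \<Rightarrow> bool" where
  "lp_linear p T \<longleftrightarrow>
     (\<forall>x\<in>lp p. \<forall>y\<in>lp p. T (\<lambda>n. x n + y n) = (\<lambda>n. T x n + T y n)) \<and>
     (\<forall>a. \<forall>x\<in>lp p. T (\<lambda>n. a * x n) = (\<lambda>n. a * T x n))"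

definition lp_isometry ::
  "real \<Rightarrow> ((nat \<Rightarrow> 'a::real_normed_field) \<Rightarrow> (nat \<Rightarrow> 'a)) \<Rightarrow> bool" where
  "lp_isometry p T \<longleftrightarrow>
     (\<forall>x\<in>lp p. \<forall>y\<in>lp p. lp_norm p (\<lambda>n. T x n - T y n) = lp_norm p (\<lambda>n. x n - y n))"

(* The image equation says both that T maps lp p into itself and that it is onto. *)
definition lp_onto_linear_isometry ::
  "real \<Rightarrow> ((nat \<Rightarrow> 'a::real_normed_field) \<Rightarrow> (nat \<Rightarrow> 'a)) \<Rightarrow> bool" where
  "lp_onto_linear_isometry p T \<longleftrightarrow> T ` lp p = lp p \<and> lp_linear p T \<and> lp_isometry p T"

definition lp_signed_permutation ::
  "real \<Rightarrow> ((nat \<Rightarrow> 'a::real_normed_field) \<Rightarrow> (nat \<Rightarrow> 'a)) \<Rightarrow> bool" where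
  "lp_signed_permutation p T \<longleftrightarrow>
     (\<exists>(\<sigma> :: nat \<Rightarrow> nat) (c :: nat \<Rightarrow> 'a).
        bij \<sigma> \<and> (\<forall>n. norm (c n) = 1) \<and> (\<forall>x\<in>lp p. T x = (\<lambda>n. c n * x (\<sigma> n))))"

end

theory Submission
  imports Defs
begin

text \<open>
  For \<open>p \<noteq> 2\<close> the norm of \<open>\<ell>\<^sub>p\<close> knows which pairs of sequences have disjoint supports.
  For scalars, \<open>\<bar>a + b\<bar>\<^sup>p + \<bar>a - b\<bar>\<^sup>p - 2 \<bar>a\<bar>\<^sup>p - 2 \<bar>b\<bar>\<^sup>p\<close> has the
  sign of \<open>p - 2\<close> whenever \<open>a\<close> and \<open>b\<close> are both nonzero, and it vanishes when one of
  them is zero. Summed over the coordinates, the terms cannot cancel, so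
  \<open>\<parallel>x + y\<parallel>\<^sup>p + \<parallel>x - y\<parallel>\<^sup>p = 2 \<parallel>x\<parallel>\<^sup>p + 2 \<parallel>y\<parallel>\<^sup>p\<close> holds exactly when
  \<open>x\<^sub>n y\<^sub>n = 0\<close> for all \<open>n\<close> (\<open>clarkson_equality_iff_disjoint\<close>). A linear isometry
  \<open>T\<close> respects this equality, hence preserves and reflects disjointness of supports
  (\<open>lp_isometry_disjoint_iff\<close>).

  The rest is algebra with disjoint sequences. Suppose that the \<open>j\<close>-th coordinate \<open>d\<close> of
  \<open>T e\<^sub>n\<close> is nonzero, and use surjectivity to write \<open>e\<^sub>j = T y\<close>. The sequence
  \<open>T e\<^sub>n - d e\<^sub>j\<close> vanishes at \<open>j\<close>, so it is disjoint from \<open>e\<^sub>j\<close>; pulling back,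
  \<open>e\<^sub>n - d y\<close> is disjoint from \<open>y\<close>, which forces \<open>y\<close> to be a multiple of \<open>e\<^sub>n\<close>.
  Thus \<open>T\<close> sends every unit sequence to a unimodular multiple of a unit sequence
  (\<open>image_of_unit_sequence\<close>). Finally \<open>x - x\<^sub>n e\<^sub>n\<close> is disjoint from \<open>e\<^sub>n\<close> for
  every \<open>x\<close>, and pushing this forward determines the coordinate of \<open>T x\<close> on the support of
  \<open>T e\<^sub>n\<close>; these supports exhaust the index set, because a unit sequence \<open>e\<^sub>j\<close>
  outside of them would have the preimage \<open>0\<close>.

  Real and complex scalars are treated together, as normed fields whose norm comes from an inner
  product; the scalar inequality rests on the parallelogram law.
\<close>

section \<open>A strict scalar inequality\<close>

lemma powr_add_strict_superadditive:
  fixes s t q :: real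
  assumes "1 < q" "0 < s" "0 < t"
  shows "s powr q + t powr q < (s + t) powr q"
proof -
  have split: "u powr q = u * u powr (q - 1)" if "0 < u" for u :: real
    using that powr_add[of u 1 "q - 1"] by simp
  have "s powr (q - 1) < (s + t) powr (q - 1)" "t powr (q - 1) < (s + t) powr (q - 1)"
    using assms by (auto intro!: powr_less_mono2)
  then have "s * s powr (q - 1) + t * t powr (q - 1)
      < s * (s + t) powr (q - 1) + t * (s + t) powr (q - 1)"
    using assms by (intro add_strict_mono mult_strict_left_mono)
  then show ?thesis
    using assms split[of s] split[of t] split[of "s + t"] by (simp add: distrib_right)
qed

lemma powr_midpoint_convex:
  fixes u v q :: real
  assumes "1 < q" "0 \<le> u" "0 \<le> v"
  shows "2 * ((u + v) / 2) powr q \<le> u powr q + v powr q"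
proof -
  have zero: "2 * (w / 2) powr q \<le> w powr q" if "0 \<le> w" for w :: real
  proof -
    have "(2::real) powr 1 \<le> 2 powr q"
      using assms by (intro powr_mono) auto
    then have "2 * w powr q \<le> 2 powr q * w powr q"
      by (intro mult_right_mono) auto
    then show ?thesis
      using that by (simp add: powr_divide field_simps)
  qed
  show ?thesis
  proof (cases "u = 0 \<or> v = 0")
    case True
    then show ?thesis using zero[of u] zero[of v] assms by auto
  next
    case False
    have "((1 - 1/2) *\<^sub>R u + (1/2) *\<^sub>R v) powr q \<le> (1 - 1/2) * u powr q + (1/2) * v powr q"
      using False assms by (intro convex_onD[OF powr_convex]) auto
    then show ?thesis by (simp add: add_divide_distrib)
  qed
qed

text \<open>
  Both inequalities above point the same way, and for \<open>q < 1\<close> both reverse: this follows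
  by applying them to the \<open>q\<close>-th powers with the exponent \<open>1 / q\<close>. The factor
  \<open>sgn (q - 1)\<close> covers both ranges of \<open>q\<close> at once.
\<close>
lemma sgn_powr_parallelogram_pos:
  fixes q s t u v :: real
  assumes "0 < q" "q \<noteq> 1" "0 < s" "0 < t" "0 \<le> u" "0 \<le> v" and uv: "u + v = 2 * (s + t)"
  shows "0 < sgn (q - 1) * (u powr q + v powr q - 2 * s powr q - 2 * t powr q)"
proof (cases "1 < q")
  case True
  have "(u + v) / 2 = s + t" using uv by simp
  then have "2 * (s + t) powr q \<le> u powr q + v powr q"
    using powr_midpoint_convex[OF True assms(5,6)] by (simp only:)
  then show ?thesis
    using powr_add_strict_superadditive[of q s t] True assms by simp
next
  case False
  then have q: "q < 1" and r: "1 < 1 / q" using assms by auto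
  have inv: "(w powr q) powr (1 / q) = w" "(w powr (1 / q)) powr q = w" if "0 \<le> w" for w
    using that assms by (auto simp: powr_powr)
  have "s + t < (s powr q + t powr q) powr (1 / q)"
    using powr_add_strict_superadditive[OF r, of "s powr q" "t powr q"] inv assms by simp
  then have "(s + t) powr q < ((s powr q + t powr q) powr (1 / q)) powr q"
    using assms by (intro powr_less_mono2) auto
  then have 1: "(s + t) powr q < s powr q + t powr q"
    using inv by simp
  have "2 * ((u powr q + v powr q) / 2) powr (1 / q) \<le> u + v"
    using powr_midpoint_convex[OF r, of "u powr q" "v powr q"] inv assms by simp
  then have "((u powr q + v powr q) / 2) powr (1 / q) \<le> s + t"
    using uv by simp
  then have "(((u powr q + v powr q) / 2) powr (1 / q)) powr q \<le> (s + t) powr q"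
    using assms by (intro powr_mono2) auto
  then have 2: "(u powr q + v powr q) / 2 \<le> (s + t) powr q"
    using inv(2)[of "(u powr q + v powr q) / 2"] by simp
  have "sgn (q - 1) = -1" using q by simp
  then show ?thesis using 1 2 by simp
qed

definition clarkson_defect :: "real \<Rightarrow> 'a::real_normed_vector \<Rightarrow> 'a \<Rightarrow> real" where
  "clarkson_defect p a b =
     norm (a + b) powr p + norm (a - b) powr p - 2 * norm a powr p - 2 * norm b powr p"

text \<open>
  By the parallelogram law, the squared norms \<open>s\<close>, \<open>t\<close> of \<open>a\<close>, \<open>b\<close> and
  \<open>u\<close>, \<open>v\<close> of \<open>a + b\<close>, \<open>a - b\<close> satisfy \<open>u + v = 2 (s + t)\<close>, and
  the \<open>p\<close>-th power of a norm is the \<open>p / 2\<close>-th power of its square.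
\<close>
lemma sgn_clarkson_defect_pos:
  fixes a b :: "'a::real_inner"
  assumes "0 < p" "p \<noteq> 2" "a \<noteq> 0" "b \<noteq> 0"
  shows "0 < sgn (p - 2) * clarkson_defect p a b"
proof -
  have sq: "(norm z ^ 2) powr (p / 2) = norm z powr p" for z :: 'a
    by (cases "z = 0") (simp_all add: powr_powr flip: powr_numeral)
  have "(norm (a + b))^2 + (norm (a - b))^2 = 2 * ((norm a)^2 + (norm b)^2)"
    by (simp add: power2_norm_eq_inner inner_add_left inner_add_right inner_diff_left
        inner_diff_right)
  then have "0 < sgn (p / 2 - 1) * clarkson_defect p a b"
    using sgn_powr_parallelogram_pos[of "p/2" "norm a ^ 2" "norm b ^ 2"
        "norm (a + b) ^ 2" "norm (a - b) ^ 2"] assms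
    by (simp add: sq clarkson_defect_def)
  moreover have "sgn (p / 2 - 1) = sgn (p - 2)"
    by (auto simp: sgn_if)
  ultimately show ?thesis by simp
qed

lemma clarkson_defect_zero [simp]:
  "clarkson_defect p 0 b = 0" "clarkson_defect p a 0 = 0"
  by (simp_all add: clarkson_defect_def)

section \<open>The sequence space\<close>

definition unit_seq :: "nat \<Rightarrow> nat \<Rightarrow> 'a::real_normed_field" where
  "unit_seq n = (\<lambda>k. if k = n then 1 else 0)"

definition disjoint_seq :: "(nat \<Rightarrow> 'a::real_normed_field) \<Rightarrow> (nat \<Rightarrow> 'a) \<Rightarrow> bool" where
  "disjoint_seq x y \<longleftrightarrow> (\<forall>n. x n * y n = 0)"

lemma lp_unit_seq: "unit_seq n \<in> lp p"
  unfolding lp_def unit_seq_def mem_Collect_eq by (rule summable_finite[of "{n}"]) auto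

lemma suminf_unit_seq_multiple:
  "(\<Sum>k. norm (c * unit_seq n k :: 'a::real_normed_field) powr p) = norm c powr p"
  by (subst suminf_finite[of "{n}"]) (auto simp: unit_seq_def)

lemma lp_scale: "x \<in> lp p \<Longrightarrow> (\<lambda>n. a * x n) \<in> lp p"
  by (auto simp: lp_def norm_mult powr_mult intro: summable_mult)

lemma lp_add:
  assumes "0 < p" "x \<in> lp p" "y \<in> lp p"
  shows "(\<lambda>n. x n + y n) \<in> lp p"
proof -
  have bound: "norm (a + b) powr p \<le> 2 powr p * (norm a powr p + norm b powr p)"
    for a b :: 'a
  proof -
    have "norm (a + b) powr p \<le> (2 * max (norm a) (norm b)) powr p"
      using assms norm_triangle_ineq[of a b] by (intro powr_mono2) auto
    also have "\<dots> = 2 powr p * (max (norm a) (norm b)) powr p"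
      by (simp add: powr_mult)
    also have "\<dots> \<le> 2 powr p * (norm a powr p + norm b powr p)"
      by (intro mult_left_mono) (auto simp: max_def)
    finally show ?thesis .
  qed
  have "summable (\<lambda>n. 2 powr p * (norm (x n) powr p + norm (y n) powr p))"
    using assms by (auto simp: lp_def intro!: summable_mult summable_add)
  then show ?thesis
    unfolding lp_def mem_Collect_eq
    by (rule summable_comparison_test[rotated]) (auto intro: bound)
qed

lemma lp_diff:
  assumes "0 < p" "x \<in> lp p" "y \<in> lp p"
  shows "(\<lambda>n. x n - y n) \<in> lp p"
  using lp_add[OF assms(1,2) lp_scale[OF assms(3), of "-1"]] by simp

lemma lp_norm_powr:
  assumes "0 < p" "x \<in> lp p"
  shows "lp_norm p x powr p = (\<Sum>n. norm (x n) powr p)"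
  using assms suminf_nonneg[of "\<lambda>n. norm (x n) powr p"]
  by (simp add: lp_norm_def lp_def powr_powr)

text \<open>
  All coordinates contribute defects of the same sign, so their sum is zero only if each of them
  is.
\<close>
lemma clarkson_equality_iff_disjoint:
  fixes x y :: "nat \<Rightarrow> 'a::{real_normed_field, real_inner}"
  assumes p: "0 < p" "p \<noteq> 2" and x: "x \<in> lp p" and y: "y \<in> lp p"
  shows "lp_norm p (\<lambda>n. x n + y n) powr p + lp_norm p (\<lambda>n. x n - y n) powr p
           = 2 * lp_norm p x powr p + 2 * lp_norm p y powr p
         \<longleftrightarrow> disjoint_seq x y"
proof -
  let ?D = "\<lambda>n. clarkson_defect p (x n) (y n)"
  have sums: "(\<lambda>n. norm (z n) powr p) sums (lp_norm p z powr p)" if "z \<in> lp p"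
    for z :: "nat \<Rightarrow> 'a"
    using that lp_norm_powr[OF p(1) that] by (simp add: lp_def summable_sums)
  have D: "?D sums (lp_norm p (\<lambda>n. x n + y n) powr p + lp_norm p (\<lambda>n. x n - y n) powr p
           - 2 * lp_norm p x powr p - 2 * lp_norm p y powr p)" (is "_ sums ?S")
    unfolding clarkson_defect_def
    using sums[OF lp_add[OF p(1) x y]] sums[OF lp_diff[OF p(1) x y]] sums[OF x] sums[OF y]
    by (intro sums_diff sums_add sums_mult)
  have nonneg: "0 \<le> sgn (p - 2) * ?D n" for n
    using sgn_clarkson_defect_pos[OF p, of "x n" "y n"]
    by (cases "x n = 0 \<or> y n = 0") auto
  have zero: "sgn (p - 2) * ?D n = 0 \<longleftrightarrow> x n * y n = 0" for n
    using sgn_clarkson_defect_pos[OF p, of "x n" "y n"]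
    by (cases "x n = 0 \<or> y n = 0") auto
  have sD: "(\<lambda>n. sgn (p - 2) * ?D n) sums (sgn (p - 2) * ?S)"
    by (rule sums_mult[OF D])
  have "?S = 0 \<longleftrightarrow> sgn (p - 2) * ?S = 0"
    using p by (simp add: sgn_eq_0_iff)
  also have "\<dots> \<longleftrightarrow> (\<forall>n. sgn (p - 2) * ?D n = 0)"
    using suminf_eq_zero_iff[OF sums_summable[OF sD] nonneg] sums_unique[OF sD] by simp
  also have "\<dots> \<longleftrightarrow> disjoint_seq x y"
    unfolding disjoint_seq_def zero ..
  finally show ?thesis by (simp add: algebra_simps)
qed

section \<open>Isometries and disjointness\<close>

lemma lp_linear_scale:
  "lp_linear p T \<Longrightarrow> x \<in> lp p \<Longrightarrow> T (\<lambda>n. a * x n) = (\<lambda>n. a * T x n)"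
  by (auto simp: lp_linear_def)

lemma lp_linear_diff_scale:
  assumes "lp_linear p T" "x \<in> lp p" "y \<in> lp p"
  shows "T (\<lambda>n. x n - a * y n) = (\<lambda>n. T x n - a * T y n)"
proof -
  have "T (\<lambda>n. x n + (- a) * y n) = (\<lambda>n. T x n + T (\<lambda>n. (- a) * y n) n)"
    by (rule assms(1)[unfolded lp_linear_def, THEN conjunct1, rule_format,
        OF assms(2) lp_scale[OF assms(3)]])
  then show ?thesis
    using lp_linear_scale[OF assms(1,3), of "- a"] by simp
qed

lemma lp_isometry_norm:
  fixes T :: "(nat \<Rightarrow> 'a::real_normed_field) \<Rightarrow> (nat \<Rightarrow> 'a)"
  assumes "lp_linear p T" "lp_isometry p T" "x \<in> lp p"
  shows "lp_norm p (T x) = lp_norm p x"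
proof -
  have 0: "(\<lambda>n. 0 :: 'a) \<in> lp p"
    using lp_scale[OF assms(3), of 0] by simp
  have "T (\<lambda>n. 0) = (\<lambda>n. 0)"
    using lp_linear_scale[OF assms(1,3), of 0] by simp
  then have "lp_norm p (\<lambda>n. T x n - 0) = lp_norm p (\<lambda>n. x n - 0)"
    using assms(2)[unfolded lp_isometry_def, rule_format, OF assms(3) 0] by simp
  then show ?thesis by simp
qed

lemma lp_isometry_disjoint_iff:
  fixes T :: "(nat \<Rightarrow> 'a::{real_normed_field, real_inner}) \<Rightarrow> (nat \<Rightarrow> 'a)"
  assumes p: "0 < p" "p \<noteq> 2" and T: "lp_onto_linear_isometry p T"
    and x: "x \<in> lp p" and y: "y \<in> lp p"
  shows "disjoint_seq (T x) (T y) \<longleftrightarrow> disjoint_seq x y"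
proof -
  have lin: "lp_linear p T" and iso: "lp_isometry p T" and into: "T x \<in> lp p" "T y \<in> lp p"
    using T x y by (auto simp: lp_onto_linear_isometry_def)
  have add: "T (\<lambda>n. x n + y n) = (\<lambda>n. T x n + T y n)"
    using lin x y by (auto simp: lp_linear_def)
  have "lp_norm p (\<lambda>n. T x n + T y n) = lp_norm p (\<lambda>n. x n + y n)"
    using lp_isometry_norm[OF lin iso lp_add[OF p(1) x y]] add by simp
  moreover have "lp_norm p (\<lambda>n. T x n - T y n) = lp_norm p (\<lambda>n. x n - y n)"
    using iso x y by (simp add: lp_isometry_def)
  ultimately show ?thesis
    using clarkson_equality_iff_disjoint[OF p into] clarkson_equality_iff_disjoint[OF p x y]
      lp_isometry_norm[OF lin iso x] lp_isometry_norm[OF lin iso y]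
    by simp
qed

section \<open>Onto isometries permute the unit sequences\<close>

lemma lp_isometry_inj:
  assumes "0 < p" "lp_linear p T" "lp_isometry p T" "x \<in> lp p" "T x = (\<lambda>n. 0)"
  shows "x = (\<lambda>n. 0)"
proof -
  have "lp_norm p x = 0"
    using lp_isometry_norm[OF assms(2-4)] assms(1,5) by (simp add: lp_norm_def)
  then have "(\<Sum>n. norm (x n) powr p) = 0"
    using lp_norm_powr[OF assms(1,4)] by simp
  then show ?thesis
    using suminf_eq_zero_iff[of "\<lambda>n. norm (x n) powr p"] assms(4)
    by (auto simp: lp_def)
qed

text \<open>
  Splitting \<open>e\<^sub>j\<close> off \<open>T e\<^sub>n\<close> leaves a disjoint remainder. The preimages are then a
  disjoint decomposition of \<open>e\<^sub>n\<close>, and one of two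
  disjoint sequences with sum \<open>e\<^sub>n\<close> is zero.
\<close>
lemma image_of_unit_sequence:
  fixes T :: "(nat \<Rightarrow> 'a::{real_normed_field, real_inner}) \<Rightarrow> (nat \<Rightarrow> 'a)"
  assumes p: "0 < p" "p \<noteq> 2" and T: "lp_onto_linear_isometry p T"
  shows "\<exists>j d. norm d = 1 \<and> T (unit_seq n) = (\<lambda>k. d * unit_seq j k)"
proof -
  have lin: "lp_linear p T" and iso: "lp_isometry p T" and onto: "T ` lp p = lp p"
    using T by (auto simp: lp_onto_linear_isometry_def)
  let ?f = "T (unit_seq n)"
  have e: "unit_seq n \<in> lp p" by (rule lp_unit_seq)
  have "unit_seq n n \<noteq> (0 :: 'a)" by (simp add: unit_seq_def)
  then have "?f \<noteq> (\<lambda>k. 0)"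
    using lp_isometry_inj[OF p(1) lin iso e] by (auto dest: fun_cong)
  then obtain j where j: "?f j \<noteq> 0" by auto
  obtain y where y: "y \<in> lp p" and Ty: "T y = unit_seq j"
    using onto lp_unit_seq[of j p] by (metis imageE)
  have r: "(\<lambda>k. unit_seq n k - ?f j * y k) \<in> lp p"
    by (rule lp_diff[OF p(1) e lp_scale[OF y]])
  have "disjoint_seq (T (\<lambda>k. unit_seq n k - ?f j * y k)) (T y)"
    unfolding lp_linear_diff_scale[OF lin e y] Ty by (auto simp: disjoint_seq_def unit_seq_def)
  then have disj: "disjoint_seq (\<lambda>k. unit_seq n k - ?f j * y k) y"
    using lp_isometry_disjoint_iff[OF p T r y] by simp
  have y0: "y k = 0" if "k \<noteq> n" for k
    using disj that j by (auto simp: disjoint_seq_def unit_seq_def dest!: spec[of _ k])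
  have y_mult: "y = (\<lambda>k. y n * unit_seq n k)"
    using y0 by (auto simp: unit_seq_def fun_eq_iff)
  have uj: "unit_seq j = (\<lambda>k. y n * ?f k)"
    using lp_linear_scale[OF lin e, of "y n"] y_mult Ty by simp
  then have "y n * ?f j = 1"
    by (auto dest: fun_cong[of _ _ j] simp: unit_seq_def)
  then have yn: "y n \<noteq> 0" by auto
  define d where "d = 1 / y n"
  have f: "?f = (\<lambda>k. d * unit_seq j k)"
    unfolding uj d_def using yn by simp
  have "norm d powr p = lp_norm p ?f powr p"
    unfolding f using lp_norm_powr[OF p(1) lp_scale[OF lp_unit_seq, where a = d]]
    by (simp add: suminf_unit_seq_multiple)
  also have "\<dots> = lp_norm p (\<lambda>k. 1 * unit_seq n k :: 'a) powr p"
    using lp_isometry_norm[OF lin iso e] by simp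
  also have "\<dots> = 1"
    using lp_norm_powr[OF p(1) lp_scale[OF lp_unit_seq, where a = "1 :: 'a"]]
    by (simp only: suminf_unit_seq_multiple) simp
  finally have "(norm d powr p) powr (1 / p) = 1" by simp
  then have "norm d = 1"
    using p by (simp add: powr_powr)
  then show ?thesis using f by blast
qed

theorem lp_onto_isometry_signed_permutation:
  fixes T :: "(nat \<Rightarrow> 'a::{real_normed_field, real_inner}) \<Rightarrow> (nat \<Rightarrow> 'a)"
  assumes p: "0 < p" "p \<noteq> 2" and T: "lp_onto_linear_isometry p T"
  shows "lp_signed_permutation p T"
proof -
  have lin: "lp_linear p T" and iso: "lp_isometry p T" and onto: "T ` lp p = lp p"
    using T by (auto simp: lp_onto_linear_isometry_def)
  have "\<forall>n. \<exists>j d. norm d = 1 \<and> T (unit_seq n) = (\<lambda>k. d * unit_seq j k)"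
    using image_of_unit_sequence[OF p T] by blast
  then obtain \<pi> d where "\<forall>n. norm (d n) = 1 \<and> T (unit_seq n) = (\<lambda>k. d n * unit_seq (\<pi> n) k)"
    unfolding choice_iff by blast
  then have d: "norm (d n) = 1" and Te: "T (unit_seq n) = (\<lambda>k. d n * unit_seq (\<pi> n) k)" for n
    by auto
  have d0: "d n \<noteq> 0" for n using d[of n] by auto
  have coord: "T x (\<pi> n) = d n * x n" if x: "x \<in> lp p" for x n
  proof -
    let ?r = "\<lambda>k. x k - x n * unit_seq n k"
    have r: "?r \<in> lp p" by (rule lp_diff[OF p(1) x lp_scale[OF lp_unit_seq]])
    have "disjoint_seq ?r (unit_seq n)"
      by (auto simp: disjoint_seq_def unit_seq_def)
    then have "disjoint_seq (T ?r) (T (unit_seq n))"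
      using lp_isometry_disjoint_iff[OF p T r lp_unit_seq] by simp
    then have "T ?r (\<pi> n) * T (unit_seq n) (\<pi> n) = 0"
      by (simp add: disjoint_seq_def)
    then show ?thesis
      using d0[of n] unfolding lp_linear_diff_scale[OF lin x lp_unit_seq] Te
      by (simp add: unit_seq_def mult.commute)
  qed
  have inj: "inj \<pi>"
  proof (rule injI, rule ccontr)
    fix m n assume eq: "\<pi> m = \<pi> n" and "m \<noteq> n"
    then have "T (unit_seq m) (\<pi> n) = 0"
      using coord[OF lp_unit_seq, of m n] by (simp add: unit_seq_def)
    then show False
      using d0[of m] unfolding Te eq by (simp add: unit_seq_def)
  qed
  have "\<exists>n. \<pi> n = j" for j
  proof (rule ccontr)
    assume no: "\<nexists>n. \<pi> n = j"
    obtain y where y: "y \<in> lp p" and Ty: "T y = unit_seq j"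
      using onto lp_unit_seq[of j p] by (metis imageE)
    have "d n * y n = 0" for n
      using coord[OF y, of n] no by (auto simp: Ty unit_seq_def)
    then have "y = (\<lambda>n. 0 * y n)" using d0 by auto
    then have "unit_seq j = (\<lambda>n. 0 * T y n)"
      using lp_linear_scale[OF lin y, of 0] Ty by simp
    then have "unit_seq j j = (0 :: 'a)" by simp
    then show False by (simp add: unit_seq_def)
  qed
  then have "surj \<pi>" unfolding surj_def by metis
  with inj have bij: "bij \<pi>" by (rule bijI)
  \<comment> \<open>\<open>\<pi>\<close> moves unit sequences, so coordinates are moved by its inverse.\<close>
  define \<sigma> where "\<sigma> = inv \<pi>"
  have \<pi>\<sigma>: "\<pi> (\<sigma> k) = k" for k
    using bij by (simp add: \<sigma>_def bij_is_surj surj_f_inv_f)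
  have "T x = (\<lambda>k. d (\<sigma> k) * x (\<sigma> k))" if "x \<in> lp p" for x
    using coord[OF that, of "\<sigma> _"] by (simp add: \<pi>\<sigma> fun_eq_iff)
  moreover have "bij \<sigma>"
    unfolding \<sigma>_def by (rule bij_imp_bij_inv[OF bij])
  ultimately show ?thesis
    unfolding lp_signed_permutation_def using d
    by (intro exI[of _ \<sigma>] exI[of _ "\<lambda>k. d (\<sigma> k)"]) auto
qed

theorem theorem4p5:
  fixes p :: real
  assumes "1 < p" and "p \<noteq> 2"
  shows "(\<forall>T :: (nat \<Rightarrow> real) \<Rightarrow> (nat \<Rightarrow> real).
            lp_onto_linear_isometry p T \<longrightarrow> lp_signed_permutation p T) \<and>
         (\<forall>T :: (nat \<Rightarrow> complex) \<Rightarrow> (nat \<Rightarrow> complex).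
            lp_onto_linear_isometry p T \<longrightarrow> lp_signed_permutation p T)"
proof -
  have "0 < p" using assms by simp
  then show ?thesis
    using lp_onto_isometry_signed_permutation[where 'a = real and p = p]
      lp_onto_isometry_signed_permutation[where 'a = complex and p = p] assms(2)
    by blast
qed

end
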